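(* Let $\lambda\in\mathbb{R}$ and $x\in\mathbb{R}$. For every integer $n\ge 0$, $$\beta_{n,\lambda}(x)=\sum_{m=0}^{n}D_{m,\lambda}(x)\,S_2(n,m).$$
   Context: All generating functions are formal power series in $t$. For $\lambda,y\in\mathbb{R}$, set $(y)_{0,\lambda}=1$ and $(y)_{n,\lambda}=y(y-\lambda)\cdots(y-(n-1)\lambda)$ for $n\ge1$; the formal power series $(1+\lambda u)^{y/\lambda}$ means $\sum_{n\ge0}(y)_{n,\lambda}\frac{u^n}{n!}$ (the usual binomial series for $\lambda\ne0$, and the limit $e^{yu}$ for $\lambda=0$). The degenerate Bernoulli polynomials $\beta_{n,\lambda}(x)$ (Carlitz) are defined by $\frac{t}{(1+\lambda t)^{1/\lambda}-1}(1+\lambda t)^{x/\lambda}=\sum_{n=0}^\infty \beta_{n,\lambda}(x)\frac{t^n}{n!}$. The degenerate Daehee polynomials of the second kind $D_{n,\lambda}(x)$ are defined by $\frac{\log(1+t)}{(1+\lambda\log(1+t))^{1/\lambda}-1}(1+\lambda\log(1+t))^{x/\lambda}=\sum_{n=0}^\infty D_{n,\lambda}(x)\frac{t^n}{n!}$. $S_2(n,l)$ are the Stirling numbers of the second kind: $x^n=\sum_{l=0}^n S_2(n,l)(x)_l$, where $(x)_0=1$ and $(x)_l=x(x-1)\cdots(x-l+1)$ for $l\ge1$. *)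

theory Defs
  imports
    "HOL-Computational_Algebra.Formal_Power_Series"
    "HOL-Combinatorics.Stirling"
begin

definition deg_ffact :: "real \<Rightarrow> real \<Rightarrow> nat \<Rightarrow> real" where
  "deg_ffact lam y n = (\<Prod>k<n. y - real k * lam)"

text \<open>The series $(1 + \lambda u)^{y/\lambda}$ in $u$; there is no side condition on
  $\lambda$, and $\lambda = 0$ gives $e^{yu}$ (see \<open>deg_exp_0\<close> and \<open>deg_exp_nonzero\<close>).\<close>

definition deg_exp :: "real \<Rightarrow> real \<Rightarrow> real fps" where
  "deg_exp lam y = Abs_fps (\<lambda>n. deg_ffact lam y n / fact n)"

text \<open>In the two quotients below numerator and denominator both have order 1, so the
  division of formal power series is exact (see \<open>deg_bernoulli_division\<close> and
  \<open>deg_daehee_division\<close>). The series \<open>fps_ln 1\<close> is $\log(1+t)$, and \<open>oo\<close> is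
  composition.\<close>

definition deg_bernoulli :: "real \<Rightarrow> nat \<Rightarrow> real \<Rightarrow> real" where
  "deg_bernoulli lam n x =
     fact n * fps_nth (fps_X / (deg_exp lam 1 - 1) * deg_exp lam x) n"

definition deg_daehee :: "real \<Rightarrow> nat \<Rightarrow> real \<Rightarrow> real" where
  "deg_daehee lam n x =
     fact n * fps_nth (fps_ln 1 / ((deg_exp lam 1 oo fps_ln 1) - 1)
                        * (deg_exp lam x oo fps_ln 1)) n"

lemma deg_exp_0: "deg_exp 0 y = fps_exp y"
  by (rule fps_ext) (simp add: deg_exp_def deg_ffact_def)

lemma deg_exp_nonzero:
  assumes "lam \<noteq> 0"
  shows "deg_exp lam y = fps_binomial (y / lam) oo (fps_const lam * fps_X)"
proof (rule fps_ext)
  fix n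
  have "(\<Prod>k<n. y - real k * lam) = (\<Prod>k<n. lam * (y / lam - real k))"
    using assms by (intro prod.cong) (auto simp: field_simps)
  also have "\<dots> = lam ^ n * (\<Prod>k<n. y / lam - real k)"
    by (simp add: prod.distrib)
  finally show "fps_nth (deg_exp lam y) n =
      fps_nth (fps_binomial (y / lam) oo (fps_const lam * fps_X)) n"
    by (simp add: deg_exp_def deg_ffact_def gbinomial_prod_rev atLeast0LessThan
        fps_compose_linear)
qed

lemma subdegree_deg_exp: "subdegree (deg_exp lam 1 - 1) = 1"
  by (rule subdegreeI) (simp_all add: deg_exp_def deg_ffact_def)

lemma deg_bernoulli_division:
  "fps_X / (deg_exp lam 1 - 1) * (deg_exp lam 1 - 1) = fps_X"
proof -
  have "deg_exp lam 1 - 1 \<noteq> 0" using subdegree_deg_exp[of lam] by force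
  then have "deg_exp lam 1 - 1 dvd fps_X"
    by (subst fps_dvd_iff)
       (simp_all only: subdegree_deg_exp fps_X_neq_zero subdegree_fps_X not_False_eq_True order_refl)
  then show ?thesis by simp
qed

lemma deg_daehee_division:
  "fps_ln 1 / ((deg_exp lam 1 oo fps_ln 1) - 1) * ((deg_exp lam 1 oo fps_ln 1) - 1) = fps_ln 1"
proof -
  have s: "subdegree ((deg_exp lam 1 oo fps_ln 1) - 1) = 1"
    by (rule subdegreeI) (simp_all add: deg_exp_def deg_ffact_def fps_compose_nth fps_ln_nth)
  then have "(deg_exp lam 1 oo fps_ln 1) - 1 \<noteq> 0" by force
  moreover have t: "subdegree (fps_ln 1 :: real fps) = 1"
    by (rule subdegreeI) (simp_all add: fps_ln_nth)
  moreover have "(fps_ln 1 :: real fps) \<noteq> 0" using t by force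
  ultimately have "(deg_exp lam 1 oo fps_ln 1) - 1 dvd fps_ln 1"
    by (subst fps_dvd_iff) (simp_all only: s t order_refl not_False_eq_True)
  then show ?thesis by simp
qed

text \<open>The library defines \<open>Stirling\<close> by recursion. The next two lemmas say that these are
  exactly the coefficients of $x^n$ in the basis of falling factorials
  $(x)_l = x(x-1)\cdots(x-l+1)$, which is \<open>deg_ffact 1 x l\<close>.\<close>

lemma power_eq_sum_Stirling: "x ^ n = (\<Sum>l\<le>n. real (Stirling n l) * deg_ffact 1 x l)"
proof (induction n)
  case 0
  show ?case by (simp add: deg_ffact_def)
next
  case (Suc n)
  have shift: "x * deg_ffact 1 x l = deg_ffact 1 x (Suc l) + real l * deg_ffact 1 x l" for l
    by (simp add: deg_ffact_def algebra_simps)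
  have "x ^ Suc n = (\<Sum>l\<le>n. real (Stirling n l) * (x * deg_ffact 1 x l))"
    by (simp add: Suc.IH sum_distrib_left mult_ac)
  also have "\<dots> = (\<Sum>l\<le>n. real (Stirling n l) * deg_ffact 1 x (Suc l))
      + (\<Sum>l\<le>n. real l * real (Stirling n l) * deg_ffact 1 x l)"
    by (simp add: shift algebra_simps sum.distrib)
  also have "(\<Sum>l\<le>n. real l * real (Stirling n l) * deg_ffact 1 x l)
      = (\<Sum>l\<le>Suc n. real l * real (Stirling n l) * deg_ffact 1 x l)"
    by simp
  also have "\<dots> = (\<Sum>l\<le>n. real (Suc l) * real (Stirling n (Suc l)) * deg_ffact 1 x (Suc l))"
    by (subst sum.atMost_Suc_shift) simp
  also have "(\<Sum>l\<le>n. real (Stirling n l) * deg_ffact 1 x (Suc l)) + \<dots>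
      = (\<Sum>l\<le>n. real (Stirling (Suc n) (Suc l)) * deg_ffact 1 x (Suc l))"
    by (simp add: sum.distrib[symmetric] algebra_simps)
  also have "\<dots> = (\<Sum>l\<le>Suc n. real (Stirling (Suc n) l) * deg_ffact 1 x l)"
    by (subst sum.atMost_Suc_shift) simp
  finally show ?case .
qed

lemma Stirling_unique:
  assumes c: "\<And>x::real. x ^ n = (\<Sum>l\<le>n. c l * deg_ffact 1 x l)" and "m \<le> n"
  shows "c m = real (Stirling n m)"
  using \<open>m \<le> n\<close>
proof (induction m rule: less_induct)
  case (less m)
  have van: "deg_ffact 1 (real m) l = 0" if "m < l" for l
    using that by (auto simp: deg_ffact_def)
  have nz: "deg_ffact 1 (real m) m \<noteq> 0"
    by (auto simp: deg_ffact_def)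
  have "(\<Sum>l\<le>n. (c l - real (Stirling n l)) * deg_ffact 1 (real m) l) = 0"
    using c[of "real m"] power_eq_sum_Stirling[of "real m" n]
    by (simp add: left_diff_distrib sum_subtractf)
  moreover have "(\<Sum>l\<le>n. (c l - real (Stirling n l)) * deg_ffact 1 (real m) l)
      = (\<Sum>l\<in>{m}. (c l - real (Stirling n l)) * deg_ffact 1 (real m) l)"
  proof (rule sum.mono_neutral_right)
    show "\<forall>l\<in>{..n} - {m}. (c l - real (Stirling n l)) * deg_ffact 1 (real m) l = 0"
    proof
      fix l assume "l \<in> {..n} - {m}"
      then show "(c l - real (Stirling n l)) * deg_ffact 1 (real m) l = 0"
        using less.IH[of l] van[of l] by (cases "l < m") auto
    qed
  qed (use less.prems in auto)
  ultimately show ?case using nz by simp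
qed

end

theory Submission
  imports Defs
begin

text \<open>Substituting $e^t - 1$ for $t$ in the generating function of the degenerate Daehee
  polynomials turns $\log(1+t)$ into $t$, hence gives the generating function of the degenerate
  Bernoulli polynomials. On coefficients this substitution is the Stirling transform, because
  $(e^t-1)^m/m! = \sum_n S_2(n,m)\,t^n/n!$.\<close>

text \<open>With E = e^t - 1 one has E' = E + 1, so the derivative of E^(k+1) is (k+1)(E^(k+1) +
  E^k). On coefficients this is the recurrence of the Stirling numbers; it involves both k and k+1,
  so \<open>m\<close> stays arbitrary in the induction on \<open>n\<close>.\<close>

lemma fps_exp_minus_1_power_nth:
  "fps_nth ((fps_exp 1 - 1) ^ m) n = (fact m * of_nat (Stirling n m) / fact n :: 'a::field_char_0)"
proof (induction n arbitrary: m)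
  case 0
  show ?case by (cases m) (simp_all add: power_0_left)
next
  case (Suc n)
  show ?case
  proof (cases m)
    case 0
    then show ?thesis by simp
  next
    case (Suc k)
    let ?E = "fps_exp (1::'a) - 1"
    have "fps_deriv (?E ^ Suc k) = fps_const (of_nat (Suc k)) * (?E ^ Suc k + ?E ^ k)"
      by (subst fps_deriv_power) (simp add: algebra_simps)
    then have "of_nat (Suc n) * fps_nth (?E ^ Suc k) (Suc n)
        = of_nat (Suc k) * (fps_nth (?E ^ Suc k) n + fps_nth (?E ^ k) n)"
      by (metis (no_types) fps_deriv_nth Suc_eq_plus1 fps_mult_left_const_nth fps_add_nth)
    also have "\<dots> = of_nat (Suc k) * (fact (Suc k) * of_nat (Stirling n (Suc k)) / fact n
        + fact k * of_nat (Stirling n k) / fact n)"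
      by (simp only: Suc.IH)
    also have "\<dots> = fact (Suc k) * of_nat (Stirling (Suc n) (Suc k)) / fact n"
      by (simp add: field_simps)
    finally have "fps_nth (?E ^ Suc k) (Suc n)
        = fact (Suc k) * of_nat (Stirling (Suc n) (Suc k)) / fact n / of_nat (Suc n)"
      by (metis nonzero_mult_div_cancel_left of_nat_neq_0)
    then show ?thesis
      unfolding Suc by (simp add: mult.commute)
  qed
qed

lemma fps_compose_exp_minus_1_nth:
  fixes f :: "'a::field_char_0 fps"
  shows "fact n * fps_nth (f oo (fps_exp 1 - 1)) n
    = (\<Sum>m=0..n. fact m * fps_nth f m * of_nat (Stirling n m))"
  by (simp add: fps_compose_nth fps_exp_minus_1_power_nth sum_distrib_left mult_ac)

text \<open>\<open>fps_ln a\<close> is log(1+t)/a, the compositional inverse of e^(at) - 1, whose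
  linear coefficient \<open>a\<close> is nonzero.\<close>

lemma fps_ln_compose_exp_minus_1:
  fixes a :: "'a::field_char_0"
  assumes "a \<noteq> 0"
  shows "fps_ln a oo (fps_exp a - 1) = fps_X"
  unfolding fps_ln_fps_exp_inv[OF assms] by (rule fps_inv) (simp_all add: assms)

text \<open>Composition is associative here since both inner series have zero constant term.\<close>

lemma compose_ln_compose_exp_minus_1:
  "(f oo fps_ln 1) oo (fps_exp 1 - 1) = (f :: 'a::field_char_0 fps)"
  by (subst fps_compose_assoc[symmetric]) (simp_all add: fps_ln_compose_exp_minus_1)

lemma deg_daehee_series_compose:
  "(fps_ln 1 / ((deg_exp lam 1 oo fps_ln 1) - 1) * (deg_exp lam x oo fps_ln 1))
      oo (fps_exp 1 - 1)
    = fps_X / (deg_exp lam 1 - 1) * deg_exp lam x"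
proof -
  let ?E = "fps_exp (1::real) - 1"
  let ?Q = "fps_ln 1 / ((deg_exp lam 1 oo fps_ln 1) - 1)"
  have E0: "fps_nth ?E 0 = 0" by simp
  \<comment> \<open>The quotient is identified by its product with the denominator: exact division
    makes that product \<open>fps_X\<close> on both sides.\<close>
  have "(?Q oo ?E) * (deg_exp lam 1 - 1) = (?Q * ((deg_exp lam 1 oo fps_ln 1) - 1)) oo ?E"
    by (simp only: fps_compose_mult_distrib[OF E0] fps_compose_sub_distrib fps_compose_1
        compose_ln_compose_exp_minus_1)
  also have "\<dots> = fps_X"
    by (simp only: deg_daehee_division fps_ln_compose_exp_minus_1[OF one_neq_zero])
  also have "\<dots> = fps_X / (deg_exp lam 1 - 1) * (deg_exp lam 1 - 1)"
    by (simp only: deg_bernoulli_division)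
  finally have "?Q oo ?E = fps_X / (deg_exp lam 1 - 1)"
    \<comment> \<open>The denominator has order 1, so it is nonzero and cancels.\<close>
    using subdegree_deg_exp[of lam] by (metis mult_right_cancel subdegree_0 zero_neq_one)
  then show ?thesis
    by (simp only: fps_compose_mult_distrib[OF E0] compose_ln_compose_exp_minus_1)
qed

theorem theorem2p3:
  fixes lam x :: real and n :: nat
  shows "deg_bernoulli lam n x = (\<Sum>m=0..n. deg_daehee lam m x * real (Stirling n m))"
  unfolding deg_bernoulli_def deg_daehee_def deg_daehee_series_compose[symmetric]
  by (rule fps_compose_exp_minus_1_nth)

end
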